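(* Let $N$ be a positive integer. For every permutation group $G\le S_N$ there exist $z_1,\dots,z_{2N}\in\mathbb{N}^N\setminus\{0\}$ such that the $2N+1$ $G$-invariant tropical polynomials $$f_{z_1},\ f_{z_2},\ \dots,\ f_{z_{2N}},\ \varepsilon_N$$ separate $G$-orbits and induce a bi-Lipschitz embedding of $\mathbb{R}^N/G$ (with the quotient metric $d$) into $\mathbb{R}^{2N+1}$. Every family of continuous $G$-invariant functions $\mathbb{R}^N\to\mathbb{R}$ that separates $G$-orbits has at least $N$ members.
   Context: $\mathbb{N}=\{0,1,2,\dots\}$. $G\le S_N$ acts on $\mathbb{R}^N$ by permutation matrices (coordinate permutations); $[x]$ is the $G$-orbit of $x$ and $d([x],[y])=\min_{g\in G}\|x-g\cdot y\|_2$. For $z\in\mathbb{R}^N$, $f_z(x):=\max_{g\in G}\langle x,g\cdot z\rangle$ (the max filter with template $z$); $\varepsilon_N(x)=x_1+\cdots+x_N$. A tropical polynomial on $\mathbb{R}^N$ is a finite maximum of functions $x\mapsto\gamma+\langle a,x\rangle$ with $\gamma\in\mathbb{R}$, $a\in\mathbb{Z}_{\ge0}^N$. A family of $G$-invariant functions separates $G$-orbits if any two points at which all members of the family agree lie in the same $G$-orbit. *)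

theory Defs
  imports "HOL-Analysis.Analysis" "HOL-Algebra.Bij"
begin

text \<open>
  The index set of the coordinates is a finite type \<open>'n\<close>, so that \<open>N = CARD('n)\<close>, and a
  permutation group \<open>G \<le> S\<^sub>N\<close> is a set \<open>G\<close> with \<open>subgroup G (BijGroup UNIV)\<close>.
\<close>

text \<open>The left action by permutation matrices: the basis vector \<open>axis i 1\<close> goes to
  \<open>axis (p i) 1\<close>.\<close>

definition perm_act :: "('n \<Rightarrow> 'n) \<Rightarrow> real ^ 'n \<Rightarrow> real ^ 'n" where
  "perm_act p x = (\<chi> i. x $ inv_into UNIV p i)"

definition perm_orbit :: "('n \<Rightarrow> 'n) set \<Rightarrow> real ^ 'n \<Rightarrow> (real ^ 'n) set" where
  "perm_orbit G x = (\<lambda>g. perm_act g x) ` G"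

definition orbit_space :: "('n \<Rightarrow> 'n) set \<Rightarrow> (real ^ 'n) set set" where
  "orbit_space G = range (perm_orbit G)"

text \<open>The quotient metric, as a function of two orbits. The description determines a unique
  value because the minimum does not depend on the representatives; see
  \<open>orbit_dist_perm_orbit\<close> below.\<close>

definition orbit_dist ::
    "('n::finite \<Rightarrow> 'n) set \<Rightarrow> (real ^ 'n) set \<Rightarrow> (real ^ 'n) set \<Rightarrow> real" where
  "orbit_dist G X Y =
     (THE r. \<exists>x y. X = perm_orbit G x \<and> Y = perm_orbit G y \<and>
                   r = Min ((\<lambda>g. norm (x - perm_act g y)) ` G))"

definition max_filter :: "('n::finite \<Rightarrow> 'n) set \<Rightarrow> real ^ 'n \<Rightarrow> real ^ 'n \<Rightarrow> real" where
  "max_filter G z x = Max ((\<lambda>g. x \<bullet> perm_act g z) ` G)"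

definition coord_sum :: "real ^ 'n::finite \<Rightarrow> real" where
  "coord_sum x = (\<Sum>i\<in>UNIV. x $ i)"

definition nat_vectors :: "(real ^ 'n) set" where
  "nat_vectors = {a. \<forall>i. a $ i \<in> \<nat>}"

definition tropical_polynomial :: "(real ^ 'n::finite \<Rightarrow> real) \<Rightarrow> bool" where
  "tropical_polynomial f \<longleftrightarrow>
     (\<exists>T. finite T \<and> T \<noteq> {} \<and> T \<subseteq> UNIV \<times> nat_vectors \<and>
          (\<forall>x. f x = Max ((\<lambda>(\<gamma>, a). \<gamma> + a \<bullet> x) ` T)))"

definition perm_invariant :: "('n \<Rightarrow> 'n) set \<Rightarrow> (real ^ 'n \<Rightarrow> real) \<Rightarrow> bool" where
  "perm_invariant G h \<longleftrightarrow> (\<forall>g\<in>G. \<forall>x. h (perm_act g x) = h x)"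

definition separates_orbits ::
    "('n \<Rightarrow> 'n) set \<Rightarrow> 'i set \<Rightarrow> ('i \<Rightarrow> real ^ 'n \<Rightarrow> real) \<Rightarrow> bool" where
  "separates_orbits G I h \<longleftrightarrow>
     (\<forall>x y. (\<forall>i\<in>I. h i x = h i y) \<longrightarrow> perm_orbit G x = perm_orbit G y)"

definition bilipschitz_embedding ::
    "'a set \<Rightarrow> ('a \<Rightarrow> 'a \<Rightarrow> real) \<Rightarrow> ('b \<Rightarrow> 'b \<Rightarrow> real) \<Rightarrow> ('a \<Rightarrow> 'b) \<Rightarrow> bool" where
  "bilipschitz_embedding M d d' \<Phi> \<longleftrightarrow>
     (\<exists>c C. 0 < c \<and> (\<forall>X\<in>M. \<forall>Y\<in>M. c * d X Y \<le> d' (\<Phi> X) (\<Phi> Y) \<and> d' (\<Phi> X) (\<Phi> Y) \<le> C * d X Y))"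

text \<open>The Euclidean distance of \<open>\<real>\<^sup>m\<close>, whose points are written as functions on \<open>{1..m}\<close>.
  Values of \<open>u\<close> and \<open>v\<close> outside \<open>{1..m}\<close> are ignored.\<close>

definition euclid_dist :: "nat \<Rightarrow> (nat \<Rightarrow> real) \<Rightarrow> (nat \<Rightarrow> real) \<Rightarrow> real" where
  "euclid_dist m u v = L2_set (\<lambda>k. u k - v k) {1..m}"

definition induces_bilipschitz_embedding ::
    "('n::finite \<Rightarrow> 'n) set \<Rightarrow> nat \<Rightarrow> (nat \<Rightarrow> real ^ 'n \<Rightarrow> real) \<Rightarrow> bool" where
  "induces_bilipschitz_embedding G m F \<longleftrightarrow>
     (\<exists>\<Phi>. (\<forall>x. \<forall>k\<in>{1..m}. \<Phi> (perm_orbit G x) k = F k x) \<and>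
          bilipschitz_embedding (orbit_space G) (orbit_dist G) (euclid_dist m) \<Phi>)"

text \<open>The family \<open>f\<^bsub>z\<^sub>1\<^esub>, \<dots>, f\<^bsub>z\<^sub>2\<^sub>N\<^esub>, \<epsilon>\<^sub>N\<close>, indexed by \<open>{1..2 * N + 1}\<close>.\<close>

definition filter_family ::
    "('n::finite \<Rightarrow> 'n) set \<Rightarrow> (nat \<Rightarrow> real ^ 'n) \<Rightarrow> nat \<Rightarrow> real ^ 'n \<Rightarrow> real" where
  "filter_family G z k = (if k \<le> 2 * CARD('n) then max_filter G (z k) else coord_sum)"

lemma subgroup_BijGroup_UNIV_D:
  assumes "subgroup G (BijGroup (UNIV :: 'n set))"
  shows "\<And>g. g \<in> G \<Longrightarrow> bij g"
    and "id \<in> G"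
    and "\<And>g h. g \<in> G \<Longrightarrow> h \<in> G \<Longrightarrow> g \<circ> h \<in> G"
    and "\<And>g. g \<in> G \<Longrightarrow> inv_into UNIV g \<in> G"
proof -
  interpret group "BijGroup (UNIV :: 'n set)" by (rule group_BijGroup)
  interpret subgroup G "BijGroup (UNIV :: 'n set)" by (rule assms)
  show bij: "bij g" if "g \<in> G" for g
    using mem_carrier[OF that] by (simp add: BijGroup_def Bij_def)
  show "id \<in> G"
    using one_closed by (simp add: BijGroup_def id_def restrict_def)
  show "g \<circ> h \<in> G" if "g \<in> G" "h \<in> G" for g h
    using m_closed[OF that] bij[OF that(1)] bij[OF that(2)]
    by (simp add: BijGroup_def Bij_def compose_def o_def restrict_def)
  show "inv_into UNIV g \<in> G" if "g \<in> G" for g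
  proof -
    have "g \<in> Bij UNIV"
      using mem_carrier[OF that] by (simp add: BijGroup_def)
    from m_inv_closed[OF that] inv_BijGroup[OF this] show ?thesis
      by (simp add: restrict_def)
  qed
qed

lemma perm_act_comp: "bij g \<Longrightarrow> bij h \<Longrightarrow> perm_act (g \<circ> h) x = perm_act g (perm_act h x)"
  by (simp add: perm_act_def o_inv_distrib vec_eq_iff)

lemma perm_act_id: "perm_act id x = x"
  by (simp add: perm_act_def vec_eq_iff)

lemma norm_perm_act_diff:
  fixes x y :: "real ^ 'n::finite"
  assumes "bij g"
  shows "norm (perm_act g x - perm_act g y) = norm (x - y)"
proof -
  have "(\<Sum>i\<in>UNIV. (norm ((x - y) $ inv_into UNIV g i))\<^sup>2) = (\<Sum>i\<in>UNIV. (norm ((x - y) $ i))\<^sup>2)"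
    by (rule sum.reindex_bij_betw) (rule bij_imp_bij_inv[OF assms])
  then show ?thesis
    by (simp add: norm_vec_def L2_set_def perm_act_def)
qed

lemma orbit_dist_perm_orbit:
  fixes x y :: "real ^ 'n::finite"
  assumes G: "subgroup G (BijGroup UNIV)"
  shows "orbit_dist G (perm_orbit G x) (perm_orbit G y) =
           Min ((\<lambda>g. norm (x - perm_act g y)) ` G)"
proof -
  note GD = subgroup_BijGroup_UNIV_D[OF G]
  have incl: "(\<lambda>g. norm (x' - perm_act g y')) ` G \<subseteq> (\<lambda>g. norm (x - perm_act g y)) ` G"
    if same: "perm_orbit G x = perm_orbit G x'" "perm_orbit G y = perm_orbit G y'"
    for x y x' y' :: "real ^ 'n"
  proof
    fix r assume "r \<in> (\<lambda>g. norm (x' - perm_act g y')) ` G"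
    then obtain g where g: "g \<in> G" "r = norm (x' - perm_act g y')" by blast
    have self: "u \<in> perm_orbit G u" for u :: "real ^ 'n"
      unfolding perm_orbit_def using imageI[OF GD(2), of "\<lambda>g. perm_act g u"] by (simp add: perm_act_id)
    obtain a where a: "a \<in> G" "x' = perm_act a x"
      using self[of x', folded same(1)] unfolding perm_orbit_def by (rule imageE)
    obtain b where b: "b \<in> G" "y' = perm_act b y"
      using self[of y', folded same(2)] unfolding perm_orbit_def by (rule imageE)
    let ?h = "inv_into UNIV a \<circ> (g \<circ> b)"
    have h: "?h \<in> G" by (intro GD(3,4) a(1) b(1) g(1))
    have "a \<circ> ?h = g \<circ> b"
      using GD(1)[OF a(1)] by (simp add: fun_eq_iff bij_is_surj surj_f_inv_f)
    then have "perm_act g y' = perm_act a (perm_act ?h y)"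
      by (simp only: b(2) perm_act_comp[OF GD(1)[OF a(1)] GD(1)[OF h], symmetric]
        perm_act_comp[OF GD(1)[OF g(1)] GD(1)[OF b(1)], symmetric])
    then have "r = norm (x - perm_act ?h y)"
      by (simp only: g(2) a(2) norm_perm_act_diff[OF GD(1)[OF a(1)]])
    then show "r \<in> (\<lambda>g. norm (x - perm_act g y)) ` G" using h by (rule image_eqI)
  qed
  have eq: "(\<lambda>g. norm (x' - perm_act g y')) ` G = (\<lambda>g. norm (x - perm_act g y)) ` G"
    if "perm_orbit G x = perm_orbit G x'" "perm_orbit G y = perm_orbit G y'" for x' y'
    by (rule equalityI[OF incl[OF that] incl[OF that[symmetric]]])
  show ?thesis
    unfolding orbit_dist_def
  proof (rule the_equality)
    show "\<exists>u v. perm_orbit G x = perm_orbit G u \<and> perm_orbit G y = perm_orbit G v \<and>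
        Min ((\<lambda>g. norm (x - perm_act g y)) ` G) = Min ((\<lambda>g. norm (u - perm_act g v)) ` G)"
      by (rule exI[of _ x], rule exI[of _ y]) simp
  next
    fix r
    assume "\<exists>u v. perm_orbit G x = perm_orbit G u \<and> perm_orbit G y = perm_orbit G v \<and>
        r = Min ((\<lambda>g. norm (u - perm_act g v)) ` G)"
    then obtain u v where "perm_orbit G x = perm_orbit G u" "perm_orbit G y = perm_orbit G v"
      and r: "r = Min ((\<lambda>g. norm (u - perm_act g v)) ` G)"
      by (elim exE conjE)
    from eq[OF this(1,2)] show "r = Min ((\<lambda>g. norm (x - perm_act g y)) ` G)"
      by (simp only: r)
  qed
qed

end

theory Submission
  imports Defs
begin

text \<open>
  Write \<open>N = CARD('n)\<close>. The heart of the matter is linear algebra. For fixed points \<open>x, y\<close> the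
  maxima defining \<open>f\<^sub>z(x)\<close> and \<open>f\<^sub>z(y)\<close> are attained at some \<open>g, h \<in> G\<close>, so the difference
  \<open>f\<^sub>z(x) - f\<^sub>z(y) = \<langle>x, g\<cdot>z\<rangle> - \<langle>y, h\<cdot>z\<rangle>\<close> is the value at \<open>(x, y)\<close> of one of finitely many linear
  functionals on \<open>\<real>\<^sup>2\<^sup>N\<close>. Given templates \<open>z\<^sub>1, \<dots>, z\<^sub>m\<close>, each choice of \<open>(g\<^sub>k, h\<^sub>k)\<close> yields a common
  kernel \<open>V \<subseteq> \<real>\<^sup>2\<^sup>N\<close>. The next functional, with elements \<open>g, h\<close> and template \<open>z\<close>, equals
  \<open>\<langle>g\<inverse>\<cdot>x - h\<inverse>\<cdot>y, z\<rangle>\<close>. So either every \<open>(x, y) \<in> V\<close> satisfies \<open>x = g h\<inverse>\<cdot>y\<close>, or a generic \<open>z\<close>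
  gives a functional that is not zero on \<open>V\<close> and cuts its dimension by one. Only finitely many
  hyperplanes have to be avoided, which natural vectors can do (\<open>ex_nat_vector_avoiding\<close>). After
  \<open>2N\<close> steps every kernel is contained in the graph of some \<open>\<gamma> \<in> G\<close>: a kernel whose dimension fell
  at each step is zero (\<open>ex_templates_pair_kernel_in_graph\<close>).

  Whenever a kernel lies in the graph of \<open>\<gamma>\<close>, the coordinates of \<open>x - \<gamma>\<cdot>y\<close> are linear
  combinations of the chosen functionals, so \<open>d([x],[y]) \<le> \<parallel>x - \<gamma>\<cdot>y\<parallel>\<close> is at most a constant times
  \<open>\<Sum>\<^sub>k \<bar>f\<^sub>z\<^sub>k(x) - f\<^sub>z\<^sub>k(y)\<bar>\<close>. There are finitely many choices of \<open>(g\<^sub>k, h\<^sub>k)\<close>, hence a uniform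
  constant. This is the lower Lipschitz bound, and it contains the separation of orbits. The upper
  bound holds for any templates because a maximum of \<open>\<parallel>z\<parallel>\<close>-Lipschitz functions is again
  \<open>\<parallel>z\<parallel>\<close>-Lipschitz. The function \<open>\<epsilon>\<^sub>N\<close> is the max filter of the all-ones vector, so the same bounds
  apply to it.

  For the last claim, distinct points near a point with pairwise distinct coordinates lie in
  distinct orbits. Fewer than \<open>N\<close> continuous invariants that separate orbits would therefore map a
  ball of \<open>\<real>\<^sup>N\<close> continuously and injectively into a coordinate hyperplane, contradicting invariance
  of domain.
\<close>

section \<open>Permutation actions and max filters\<close>

lemma linear_perm_act: "linear (perm_act p)"
  by (rule linearI) (simp_all add: perm_act_def vec_eq_iff)

lemma perm_act_inv_cancel:
  assumes "bij g"
  shows "perm_act (inv_into UNIV g) (perm_act g x) = x"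
    and "perm_act g (perm_act (inv_into UNIV g) x) = x"
  using assms
  by (simp_all add: perm_act_def vec_eq_iff inv_inv_eq bij_is_inj bij_is_surj surj_f_inv_f)

lemma inner_perm_act_left:
  fixes x y :: "real ^ 'n::finite"
  assumes "bij g"
  shows "perm_act g x \<bullet> y = x \<bullet> perm_act (inv_into UNIV g) y"
proof -
  have "(\<Sum>i\<in>UNIV. x $ inv_into UNIV g i * y $ g (inv_into UNIV g i)) = (\<Sum>i\<in>UNIV. x $ i * y $ g i)"
    by (rule sum.reindex_bij_betw) (rule bij_imp_bij_inv[OF assms])
  then show ?thesis
    using assms by (simp add: inner_vec_def perm_act_def inv_inv_eq bij_is_surj surj_f_inv_f)
qed

lemma inner_perm_act_right:
  fixes x y :: "real ^ 'n::finite"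
  assumes "bij g"
  shows "x \<bullet> perm_act g y = perm_act (inv_into UNIV g) x \<bullet> y"
  using inner_perm_act_left[OF assms, of y x] by (simp add: inner_commute)

lemma norm_perm_act:
  fixes x :: "real ^ 'n::finite"
  assumes "bij g"
  shows "norm (perm_act g x) = norm x"
  using norm_perm_act_diff[OF assms, of x 0] linear_0[OF linear_perm_act, of g] by simp

locale perm_group =
  fixes G :: "('n::finite \<Rightarrow> 'n) set"
  assumes subgroup_G: "subgroup G (BijGroup UNIV)"
begin

lemmas bij_G = subgroup_BijGroup_UNIV_D(1)[OF subgroup_G]
  and id_in_G = subgroup_BijGroup_UNIV_D(2)[OF subgroup_G]
  and comp_in_G = subgroup_BijGroup_UNIV_D(3)[OF subgroup_G]
  and inv_in_G = subgroup_BijGroup_UNIV_D(4)[OF subgroup_G]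

lemma finite_G: "finite G"
  by (rule finite)

lemma mem_perm_orbit_self: "x \<in> perm_orbit G x"
  unfolding perm_orbit_def using imageI[OF id_in_G, of "\<lambda>g. perm_act g x"] by (simp add: perm_act_id)

lemma perm_orbit_eq_imp:
  assumes "perm_orbit G x = perm_orbit G y"
  shows "\<exists>g\<in>G. x = perm_act g y"
  using mem_perm_orbit_self[of x] unfolding assms by (auto simp: perm_orbit_def)

lemma perm_orbit_perm_act:
  assumes "g \<in> G"
  shows "perm_orbit G (perm_act g x) = perm_orbit G x"
proof -
  have "perm_orbit G (perm_act h y) \<subseteq> perm_orbit G y" if "h \<in> G" for h y
    using that by (auto simp: perm_orbit_def perm_act_comp[symmetric] bij_G comp_in_G)
  from this[OF assms, of x] this[OF inv_in_G[OF assms], of "perm_act g x"] show ?thesis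
    by (simp add: perm_act_inv_cancel bij_G assms)
qed

lemma orbit_dist_le:
  assumes "g \<in> G"
  shows "orbit_dist G (perm_orbit G x) (perm_orbit G y) \<le> norm (x - perm_act g y)"
  unfolding orbit_dist_perm_orbit[OF subgroup_G]
  using assms finite_G by (intro Min_le) auto

lemma orbit_dist_attained:
  "\<exists>g\<in>G. orbit_dist G (perm_orbit G x) (perm_orbit G y) = norm (x - perm_act g y)"
proof -
  have "Min ((\<lambda>g. norm (x - perm_act g y)) ` G) \<in> (\<lambda>g. norm (x - perm_act g y)) ` G"
    using finite_G id_in_G by (intro Min_in) auto
  then show ?thesis
    by (auto simp: orbit_dist_perm_orbit[OF subgroup_G])
qed

lemma inner_le_max_filter: "g \<in> G \<Longrightarrow> x \<bullet> perm_act g z \<le> max_filter G z x"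
  unfolding max_filter_def using finite_G by (intro Max_ge) auto

lemma max_filter_attained: "\<exists>g\<in>G. max_filter G z x = x \<bullet> perm_act g z"
proof -
  have "Max ((\<lambda>g. x \<bullet> perm_act g z) ` G) \<in> (\<lambda>g. x \<bullet> perm_act g z) ` G"
    using finite_G id_in_G by (intro Max_in) auto
  then show ?thesis by (auto simp: max_filter_def)
qed

lemma max_filter_perm_act:
  assumes "h \<in> G"
  shows "max_filter G z (perm_act h x) = max_filter G z x"
proof -
  have le: "max_filter G z (perm_act k y) \<le> max_filter G z y" if "k \<in> G" for k y
  proof -
    obtain g where g: "g \<in> G" "max_filter G z (perm_act k y) = perm_act k y \<bullet> perm_act g z"
      using max_filter_attained by blast
    note g(2)
    also have "perm_act k y \<bullet> perm_act g z = y \<bullet> perm_act (inv_into UNIV k \<circ> g) z"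
      using that g(1) by (simp add: inner_perm_act_left bij_G perm_act_comp inv_in_G)
    also have "\<dots> \<le> max_filter G z y"
      by (intro inner_le_max_filter comp_in_G inv_in_G that g(1))
    finally show ?thesis .
  qed
  from le[OF assms, of x] le[OF inv_in_G[OF assms], of "perm_act h x"] show ?thesis
    by (simp add: perm_act_inv_cancel bij_G assms)
qed

lemma max_filter_lipschitz: "\<bar>max_filter G z x - max_filter G z y\<bar> \<le> norm z * norm (x - y)"
proof -
  have le: "max_filter G z u - max_filter G z v \<le> norm z * norm (u - v)" for u v
  proof -
    obtain g where g: "g \<in> G" "max_filter G z u = u \<bullet> perm_act g z"
      using max_filter_attained by blast
    have "max_filter G z u - max_filter G z v \<le> (u - v) \<bullet> perm_act g z"
      using inner_le_max_filter[OF g(1), of v z] g(2) by (simp add: inner_diff_left)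
    also have "\<dots> \<le> norm (u - v) * norm (perm_act g z)"
      by (rule norm_cauchy_schwarz)
    finally show ?thesis
      by (simp add: norm_perm_act bij_G g(1) mult.commute)
  qed
  from le[of x y] le[of y x] show ?thesis
    by (simp add: norm_minus_commute)
qed

lemma max_filter_orbit_dist_le:
  "\<bar>max_filter G z x - max_filter G z y\<bar> \<le> norm z * orbit_dist G (perm_orbit G x) (perm_orbit G y)"
proof -
  obtain g where g: "g \<in> G" "orbit_dist G (perm_orbit G x) (perm_orbit G y) = norm (x - perm_act g y)"
    using orbit_dist_attained by blast
  from max_filter_lipschitz[of z x "perm_act g y"] show ?thesis
    by (simp add: g max_filter_perm_act)
qed

lemma tropical_polynomial_max_filter:
  assumes "z \<in> nat_vectors"
  shows "tropical_polynomial (max_filter G z)"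
proof -
  let ?T = "(\<lambda>g. (0::real, perm_act g z)) ` G"
  have "?T \<subseteq> UNIV \<times> nat_vectors"
    using assms by (auto simp: nat_vectors_def perm_act_def)
  moreover have "\<forall>x. max_filter G z x = Max ((\<lambda>(\<gamma>, a). \<gamma> + a \<bullet> x) ` ?T)"
    by (simp add: max_filter_def image_image inner_commute)
  ultimately show ?thesis
    unfolding tropical_polynomial_def using finite_G id_in_G by (intro exI[of _ ?T]) auto
qed

lemma coord_sum_eq_max_filter: "coord_sum = max_filter G (\<chi> i. 1)"
proof
  fix x :: "real ^ 'n"
  obtain g where "max_filter G (\<chi> i. 1) x = x \<bullet> perm_act g (\<chi> i. 1)"
    using max_filter_attained by blast
  then show "coord_sum x = max_filter G (\<chi> i. 1) x"
    by (simp add: coord_sum_def perm_act_def inner_vec_def)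
qed

end

section \<open>Generic natural templates\<close>

text \<open>
  Finitely many hyperplanes through the origin do not cover the natural vectors: if \<open>w\<close> avoids the
  previous hyperplanes and \<open>q\<close> has a non-zero entry at \<open>j\<close>, then \<open>M w + e\<^sub>j\<close> works for all but
  finitely many \<open>M\<close>.
\<close>

lemma ex_nat_vector_avoiding:
  fixes P :: "(real ^ 'n::finite) set"
  assumes "finite P" and "0 \<notin> P"
  shows "\<exists>w\<in>nat_vectors. \<forall>p\<in>P. p \<bullet> w \<noteq> 0"
  using assms
proof (induction P rule: finite_induct)
  case empty
  have "(0 :: real ^ 'n) \<in> nat_vectors" by (simp add: nat_vectors_def)
  then show ?case by blast
next
  case (insert q P)
  then obtain w where w: "w \<in> nat_vectors" "\<forall>p\<in>P. p \<bullet> w \<noteq> 0" by auto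
  from insert.prems obtain j where j: "q $ j \<noteq> 0"
    by (auto simp: vec_eq_iff)
  let ?bad = "(\<lambda>p. - (p $ j) / (p \<bullet> w)) ` insert q P"
  have "finite {M :: nat. real M \<in> ?bad}"
    using finite_vimageI[of ?bad real] insert.hyps(1) by (simp add: vimage_def inj_on_def)
  then obtain M :: nat where M: "real M \<notin> ?bad"
    using infinite_UNIV_nat by (metis (mono_tags) ex_new_if_finite mem_Collect_eq)
  let ?w = "real M *\<^sub>R w + axis j 1"
  have "?w \<in> nat_vectors"
    using w(1) by (auto simp: nat_vectors_def axis_def)
  moreover have "p \<bullet> ?w \<noteq> 0" if "p \<in> insert q P" for p
  proof (cases "p \<bullet> w = 0")
    case True
    with that w(2) j show ?thesis
      by (auto simp: inner_add_right inner_axis)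
  next
    case False
    have "real M \<noteq> - (p $ j) / (p \<bullet> w)" using M that by blast
    with False have "real M * (p \<bullet> w) + p $ j \<noteq> 0"
      by (auto simp: field_simps eq_neg_iff_add_eq_0)
    then show ?thesis by (simp add: inner_add_right inner_axis)
  qed
  ultimately show ?case by blast
qed

text \<open>
  The vector representing the functional \<open>(x, y) \<mapsto> \<langle>x, g\<cdot>w\<rangle> - \<langle>y, h\<cdot>w\<rangle>\<close> on \<open>\<real>\<^sup>N \<times> \<real>\<^sup>N\<close>, where
  \<open>p = (g, h)\<close>.
\<close>

definition pair_functional ::
    "('n \<Rightarrow> 'n) \<times> ('n \<Rightarrow> 'n) \<Rightarrow> real ^ 'n \<Rightarrow> (real ^ 'n) \<times> (real ^ 'n)" where
  "pair_functional p w = (perm_act (fst p) w, - perm_act (snd p) w)"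

definition pair_kernel ::
    "(nat \<Rightarrow> real ^ 'n::finite) \<Rightarrow> (nat \<Rightarrow> ('n \<Rightarrow> 'n) \<times> ('n \<Rightarrow> 'n)) \<Rightarrow> nat \<Rightarrow>
     ((real ^ 'n) \<times> (real ^ 'n)) set" where
  "pair_kernel z \<sigma> m = {v. \<forall>k\<in>{1..m}. pair_functional (\<sigma> k) (z k) \<bullet> v = 0}"

definition perm_graph :: "('n \<Rightarrow> 'n) \<Rightarrow> ((real ^ 'n) \<times> (real ^ 'n)) set" where
  "perm_graph \<gamma> = {(x, y). x = perm_act \<gamma> y}"

definition transported_diff ::
    "('n \<Rightarrow> 'n) \<times> ('n \<Rightarrow> 'n) \<Rightarrow> (real ^ 'n) \<times> (real ^ 'n) \<Rightarrow> real ^ 'n" where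
  "transported_diff p v =
     perm_act (inv_into UNIV (fst p)) (fst v) - perm_act (inv_into UNIV (snd p)) (snd v)"

lemma subspace_pair_kernel: "subspace (pair_kernel z \<sigma> m)"
  by (auto simp: pair_kernel_def subspace_def inner_add_right)

lemma pair_kernel_Suc:
  "pair_kernel z \<sigma> (Suc m) = {v \<in> pair_kernel z \<sigma> m. pair_functional (\<sigma> (Suc m)) (z (Suc m)) \<bullet> v = 0}"
  by (auto simp: pair_kernel_def atLeastAtMostSuc_conv)

lemma pair_kernel_cong:
  assumes "\<And>k. k \<in> {1..m} \<Longrightarrow> z k = z' k" and "\<And>k. k \<in> {1..m} \<Longrightarrow> \<sigma> k = \<sigma>' k"
  shows "pair_kernel z \<sigma> m = pair_kernel z' \<sigma>' m"
  using assms by (simp add: pair_kernel_def)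

lemma inner_pair_functional:
  fixes w :: "real ^ 'n::finite"
  assumes "bij (fst p)" "bij (snd p)"
  shows "pair_functional p w \<bullet> v = transported_diff p v \<bullet> w"
  using inner_perm_act_right[OF assms(1), of "fst v" w] inner_perm_act_right[OF assms(2), of "snd v" w]
  by (simp add: pair_functional_def transported_diff_def inner_prod_def inner_diff_right inner_commute)

context perm_group
begin

lemma transported_diff_eq_0_imp:
  assumes "p \<in> G \<times> G" and "transported_diff p v = 0"
  shows "v \<in> perm_graph (fst p \<circ> inv_into UNIV (snd p))"
proof -
  have "perm_act (fst p) (perm_act (inv_into UNIV (fst p)) (fst v)) =
        perm_act (fst p) (perm_act (inv_into UNIV (snd p)) (snd v))"
    using assms(2) by (simp add: transported_diff_def)
  with assms(1) show ?thesis
    by (auto simp: perm_graph_def perm_act_inv_cancel bij_G inv_in_G perm_act_comp)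
qed

text \<open>
  A new template is generic when, for every previous choice \<open>\<sigma>\<close> and every pair of group elements,
  it is not orthogonal to one chosen non-zero vector \<open>g\<inverse>\<cdot>x - h\<inverse>\<cdot>y\<close> with \<open>(x, y)\<close> in the kernel,
  if there is one. If there is none, the kernel lies in the graph of \<open>g h\<inverse>\<close>. Otherwise the new
  functional is not zero on the kernel, whose dimension decreases.
\<close>

lemma ex_templates_pair_kernel_small:
  "\<exists>z. (\<forall>k\<in>{1..m}. z k \<in> nat_vectors - {0}) \<and>
       (\<forall>\<sigma>. (\<forall>k\<in>{1..m}. \<sigma> k \<in> G \<times> G) \<longrightarrow>
            (\<exists>\<gamma>\<in>G. pair_kernel z \<sigma> m \<subseteq> perm_graph \<gamma>) \<or>
            dim (pair_kernel z \<sigma> m) + m \<le> 2 * CARD('n))"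
proof (induction m)
  case 0
  have "dim (pair_kernel z \<sigma> 0) \<le> 2 * CARD('n)" for z :: "nat \<Rightarrow> real ^ 'n" and \<sigma>
    using dim_subset_UNIV[of "pair_kernel z \<sigma> 0"] by simp
  then show ?case by simp
next
  case (Suc m)
  then obtain z where z: "\<And>k. k \<in> {1..m} \<Longrightarrow> z k \<in> nat_vectors - {0}"
    and small: "\<And>\<sigma>. (\<forall>k\<in>{1..m}. \<sigma> k \<in> G \<times> G) \<Longrightarrow>
            (\<exists>\<gamma>\<in>G. pair_kernel z \<sigma> m \<subseteq> perm_graph \<gamma>) \<or>
            dim (pair_kernel z \<sigma> m) + m \<le> 2 * CARD('n)"
    by blast
  let ?S = "PiE {1..m} (\<lambda>_. G \<times> G)"
  define t where "t = (\<lambda>(\<sigma>, p). transported_diff p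
      (SOME v. v \<in> pair_kernel z \<sigma> m \<and> transported_diff p v \<noteq> 0))"
  \<comment> \<open>The unit vector is included only to force the new template to be non-zero.\<close>
  define P where "P = (t ` (?S \<times> (G \<times> G)) \<union> {axis undefined 1}) - {0}"
  have "finite P"
    unfolding P_def using finite_G by (intro finite_Diff finite_UnI finite_imageI finite_cartesian_product finite_PiE) auto
  then obtain w where w: "w \<in> nat_vectors" and avoid: "\<And>p. p \<in> P \<Longrightarrow> p \<bullet> w \<noteq> 0"
    using ex_nat_vector_avoiding[of P] by (auto simp: P_def)
  have "axis undefined 1 \<in> P"
    by (simp add: P_def axis_eq_0_iff)
  from avoid[OF this] have "w \<noteq> 0" by auto
  define z' where "z' = z(Suc m := w)"
  have "\<forall>k\<in>{1..Suc m}. z' k \<in> nat_vectors - {0}"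
    using z w \<open>w \<noteq> 0\<close> by (auto simp: z'_def)
  moreover have "(\<exists>\<gamma>\<in>G. pair_kernel z' \<sigma> (Suc m) \<subseteq> perm_graph \<gamma>) \<or>
      dim (pair_kernel z' \<sigma> (Suc m)) + Suc m \<le> 2 * CARD('n)"
    if \<sigma>: "\<forall>k\<in>{1..Suc m}. \<sigma> k \<in> G \<times> G" for \<sigma>
  proof -
    let ?p = "\<sigma> (Suc m)" and ?\<rho> = "restrict \<sigma> {1..m}"
    let ?V = "pair_kernel z \<sigma> m"
    have p: "?p \<in> G \<times> G" using \<sigma> by auto
    have V: "pair_kernel z ?\<rho> m = ?V" "pair_kernel z' \<sigma> m = ?V"
      by (rule pair_kernel_cong; simp add: z'_def)+
    have w': "z' (Suc m) = w" by (simp add: z'_def)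
    have V': "pair_kernel z' \<sigma> (Suc m) = {v \<in> ?V. transported_diff ?p v \<bullet> w = 0}"
      using p by (auto simp: pair_kernel_Suc V w' inner_pair_functional bij_G mem_Times_iff)
    show ?thesis
    proof (cases "\<exists>v\<in>?V. transported_diff ?p v \<noteq> 0")
      case False
      then have "pair_kernel z' \<sigma> (Suc m) \<subseteq> perm_graph (fst ?p \<circ> inv_into UNIV (snd ?p))"
        using transported_diff_eq_0_imp[OF p] V' by blast
      moreover have "fst ?p \<circ> inv_into UNIV (snd ?p) \<in> G"
        using p by (intro comp_in_G inv_in_G) auto
      ultimately show ?thesis by blast
    next
      case True
      define v where "v = (SOME v. v \<in> ?V \<and> transported_diff ?p v \<noteq> 0)"
      have v: "v \<in> ?V" "transported_diff ?p v \<noteq> 0"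
        using someI_ex[of "\<lambda>v. v \<in> ?V \<and> transported_diff ?p v \<noteq> 0"] True
        unfolding v_def by blast+
      have "?\<rho> \<in> ?S" using \<sigma> by auto
      then have "t (?\<rho>, ?p) \<in> t ` (?S \<times> (G \<times> G))"
        using p by (intro imageI SigmaI)
      moreover have "t (?\<rho>, ?p) = transported_diff ?p v"
        by (simp only: t_def v_def prod.case V(1))
      ultimately have "transported_diff ?p v \<in> P"
        using v(2) unfolding P_def by (metis DiffI UnI1 singletonD)
      then have "v \<notin> pair_kernel z' \<sigma> (Suc m)"
        using avoid V' by blast
      then have "pair_kernel z' \<sigma> (Suc m) \<subset> ?V"
        using v(1) V' by blast
      then have "dim (pair_kernel z' \<sigma> (Suc m)) < dim ?V"
        by (intro dim_psubset) (simp add: span_eq_iff[THEN iffD2] subspace_pair_kernel)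
      moreover have "(\<exists>\<gamma>\<in>G. ?V \<subseteq> perm_graph \<gamma>) \<or> dim ?V + m \<le> 2 * CARD('n)"
        using small \<sigma> by auto
      ultimately show ?thesis
        using V' by force
    qed
  qed
  ultimately show ?case by blast
qed

lemma ex_templates_pair_kernel_in_graph:
  "\<exists>z. (\<forall>k\<in>{1..2 * CARD('n)}. z k \<in> nat_vectors - {0}) \<and>
       (\<forall>\<sigma>. (\<forall>k\<in>{1..2 * CARD('n)}. \<sigma> k \<in> G \<times> G) \<longrightarrow>
            (\<exists>\<gamma>\<in>G. pair_kernel z \<sigma> (2 * CARD('n)) \<subseteq> perm_graph \<gamma>))"
proof -
  let ?m = "2 * CARD('n)"
  obtain z where z: "\<forall>k\<in>{1..?m}. z k \<in> nat_vectors - {0}"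
    and small: "\<And>\<sigma>. (\<forall>k\<in>{1..?m}. \<sigma> k \<in> G \<times> G) \<Longrightarrow>
            (\<exists>\<gamma>\<in>G. pair_kernel z \<sigma> ?m \<subseteq> perm_graph \<gamma>) \<or> dim (pair_kernel z \<sigma> ?m) + ?m \<le> ?m"
    using ex_templates_pair_kernel_small[of ?m] by blast
  have "\<exists>\<gamma>\<in>G. pair_kernel z \<sigma> ?m \<subseteq> perm_graph \<gamma>" if \<sigma>: "\<forall>k\<in>{1..?m}. \<sigma> k \<in> G \<times> G" for \<sigma>
    using small[OF \<sigma>]
  proof
    assume "dim (pair_kernel z \<sigma> ?m) + ?m \<le> ?m"
    then have "pair_kernel z \<sigma> ?m \<subseteq> {0}" by simp
    also have "{0} \<subseteq> perm_graph id"
      by (simp add: perm_graph_def perm_act_id zero_prod_def)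
    finally show ?thesis using id_in_G by blast
  qed
  with z show ?thesis by blast
qed

end

section \<open>The lower Lipschitz bound\<close>

text \<open>
  A functional that vanishes on the common kernel of the functionals \<open>a i\<close> lies in their span, and
  the vectors \<open>u\<close> for which a constant exists form a subspace that contains every \<open>a i\<close>.
\<close>

lemma inner_bounded_by_functionals:
  fixes u :: "'a::euclidean_space" and a :: "'b \<Rightarrow> 'a"
  assumes "finite I" and ker: "\<And>v. (\<forall>i\<in>I. a i \<bullet> v = 0) \<Longrightarrow> u \<bullet> v = 0"
  shows "\<exists>C\<ge>0. \<forall>v. \<bar>u \<bullet> v\<bar> \<le> C * (\<Sum>i\<in>I. \<bar>a i \<bullet> v\<bar>)"
proof -
  let ?B = "\<lambda>u C. C \<ge> 0 \<and> (\<forall>v. \<bar>u \<bullet> v\<bar> \<le> C * (\<Sum>i\<in>I. \<bar>a i \<bullet> v\<bar>))"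
  obtain y w where y: "y \<in> span (a ` I)" and w: "\<And>v. v \<in> span (a ` I) \<Longrightarrow> orthogonal w v"
    and u: "u = y + w"
    using orthogonal_subspace_decomp_exists[of "a ` I" u] by blast
  have aw: "a i \<bullet> w = 0" if "i \<in> I" for i
    using w[of "a i"] that by (auto simp: orthogonal_def inner_commute intro: span_base)
  have "u \<bullet> w = 0"
    by (rule ker) (simp add: aw)
  moreover have "y \<bullet> w = 0"
    using w[OF y] by (simp add: orthogonal_def inner_commute)
  ultimately have "w = 0"
    by (simp add: u inner_add_left)
  with u y have "u \<in> span (a ` I)" by simp
  moreover have "subspace {u. \<exists>C. ?B u C}"
  proof (rule subspaceI)
    show "0 \<in> {u. \<exists>C. ?B u C}" by (auto intro: exI[of _ 0])
  next
    fix u u' assume "u \<in> {u. \<exists>C. ?B u C}" "u' \<in> {u. \<exists>C. ?B u C}"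
    then obtain C C' where C: "?B u C" and C': "?B u' C'" by blast
    have "\<bar>(u + u') \<bullet> v\<bar> \<le> (C + C') * (\<Sum>i\<in>I. \<bar>a i \<bullet> v\<bar>)" for v
    proof -
      have "\<bar>(u + u') \<bullet> v\<bar> \<le> \<bar>u \<bullet> v\<bar> + \<bar>u' \<bullet> v\<bar>"
        by (simp add: inner_add_left abs_triangle_ineq)
      also have "\<dots> \<le> C * (\<Sum>i\<in>I. \<bar>a i \<bullet> v\<bar>) + C' * (\<Sum>i\<in>I. \<bar>a i \<bullet> v\<bar>)"
        using C C' by (intro add_mono) auto
      finally show ?thesis by (simp add: distrib_right)
    qed
    with C C' have "?B (u + u') (C + C')" by simp
    then show "u + u' \<in> {u. \<exists>C. ?B u C}" by blast
  next
    fix c u assume "u \<in> {u. \<exists>C. ?B u C}"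
    then obtain C where C: "?B u C" by blast
    then have "?B (c *\<^sub>R u) (\<bar>c\<bar> * C)"
      by (simp add: abs_mult mult.assoc mult_left_mono)
    then show "c *\<^sub>R u \<in> {u. \<exists>C. ?B u C}" by blast
  qed
  moreover have "\<exists>C. ?B (a i) C" if "i \<in> I" for i
  proof (rule exI[of _ 1], intro conjI allI)
    fix v
    show "\<bar>a i \<bullet> v\<bar> \<le> 1 * (\<Sum>i\<in>I. \<bar>a i \<bullet> v\<bar>)"
      using member_le_sum[of i I "\<lambda>i. \<bar>a i \<bullet> v\<bar>"] that assms(1) by simp
  qed simp
  ultimately have "u \<in> {u. \<exists>C. ?B u C}"
    using span_minimal[of "a ` I" "{u. \<exists>C. ?B u C}"] by blast
  then show ?thesis by blast
qed

context perm_group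
begin

lemma norm_diff_bounded_of_kernel_in_graph:
  assumes "\<gamma> \<in> G" and sub: "pair_kernel z \<sigma> m \<subseteq> perm_graph \<gamma>"
  shows "\<exists>C\<ge>0. \<forall>x y. norm (x - perm_act \<gamma> y) \<le>
           C * (\<Sum>k=1..m. \<bar>pair_functional (\<sigma> k) (z k) \<bullet> (x, y)\<bar>)"
proof -
  let ?a = "\<lambda>k. pair_functional (\<sigma> k) (z k)"
  \<comment> \<open>The vector of the functional that takes \<open>(x, y)\<close> to the \<open>j\<close>-th entry of \<open>x - \<gamma>\<cdot>y\<close>.\<close>
  let ?u = "\<lambda>j. (axis j 1, - axis (inv_into UNIV \<gamma> j) 1) :: (real ^ 'n) \<times> (real ^ 'n)"
  have u: "?u j \<bullet> (x, y) = (x - perm_act \<gamma> y) $ j" for j x y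
    by (simp add: perm_act_def inner_axis' inner_minus_left)
  have "\<exists>C\<ge>0. \<forall>v. \<bar>?u j \<bullet> v\<bar> \<le> C * (\<Sum>k=1..m. \<bar>?a k \<bullet> v\<bar>)" for j
  proof (rule inner_bounded_by_functionals)
    fix v assume "\<forall>k\<in>{1..m}. ?a k \<bullet> v = 0"
    then have "v \<in> perm_graph \<gamma>" using sub by (auto simp: pair_kernel_def)
    then obtain y where "v = (perm_act \<gamma> y, y)" by (auto simp: perm_graph_def)
    then show "?u j \<bullet> v = 0" using u[of j "perm_act \<gamma> y" y] by simp
  qed simp
  then have "\<exists>C. \<forall>j. C j \<ge> 0 \<and> (\<forall>v. \<bar>?u j \<bullet> v\<bar> \<le> C j * (\<Sum>k=1..m. \<bar>?a k \<bullet> v\<bar>))"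
    by (intro choice allI)
  then obtain C where C: "\<And>j. C j \<ge> 0" "\<And>j v. \<bar>?u j \<bullet> v\<bar> \<le> C j * (\<Sum>k=1..m. \<bar>?a k \<bullet> v\<bar>)"
    by blast
  have "norm (x - perm_act \<gamma> y) \<le> (\<Sum>j\<in>UNIV. C j) * (\<Sum>k=1..m. \<bar>?a k \<bullet> (x, y)\<bar>)" for x y
  proof -
    have "norm (x - perm_act \<gamma> y) \<le> (\<Sum>j\<in>UNIV. \<bar>(x - perm_act \<gamma> y) $ j\<bar>)"
      by (rule norm_le_l1_cart)
    also have "\<dots> \<le> (\<Sum>j\<in>UNIV. C j * (\<Sum>k=1..m. \<bar>?a k \<bullet> (x, y)\<bar>))"
      unfolding u[symmetric] by (intro sum_mono C(2))
    finally show ?thesis by (simp add: sum_distrib_right)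
  qed
  moreover have "(\<Sum>j\<in>UNIV. C j) \<ge> 0" by (intro sum_nonneg C(1))
  ultimately show ?thesis by blast
qed

text \<open>
  For each \<open>x\<close> and \<open>y\<close> the differences of the max filters are the functionals of some choice \<open>\<sigma>\<close>, and
  the constants of the finitely many choices have a common bound.
\<close>

lemma orbit_dist_bounded_by_max_filters:
  assumes graph: "\<And>\<sigma>. (\<forall>k\<in>{1..m}. \<sigma> k \<in> G \<times> G) \<Longrightarrow> \<exists>\<gamma>\<in>G. pair_kernel z \<sigma> m \<subseteq> perm_graph \<gamma>"
  shows "\<exists>C>0. \<forall>x y. orbit_dist G (perm_orbit G x) (perm_orbit G y) \<le>
           C * (\<Sum>k=1..m. \<bar>max_filter G (z k) x - max_filter G (z k) y\<bar>)"
proof -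
  let ?S = "PiE {1..m} (\<lambda>_. G \<times> G)"
  let ?d = "\<lambda>x y. orbit_dist G (perm_orbit G x) (perm_orbit G y)"
  let ?B = "\<lambda>\<sigma> C. C \<ge> 0 \<and> (\<forall>x y. ?d x y \<le> C * (\<Sum>k=1..m. \<bar>pair_functional (\<sigma> k) (z k) \<bullet> (x, y)\<bar>))"
  have "finite ?S"
    using finite_G by (intro finite_PiE) auto
  have "\<exists>C. ?B \<sigma> C" if "\<sigma> \<in> ?S" for \<sigma>
  proof -
    have "\<forall>k\<in>{1..m}. \<sigma> k \<in> G \<times> G" using that by (auto simp: PiE_iff)
    then obtain \<gamma> where "\<gamma> \<in> G" "pair_kernel z \<sigma> m \<subseteq> perm_graph \<gamma>"
      using graph by blast
    with norm_diff_bounded_of_kernel_in_graph[OF this] show ?thesis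
      by (meson orbit_dist_le order_trans)
  qed
  then have "\<exists>C. \<forall>\<sigma>\<in>?S. ?B \<sigma> (C \<sigma>)" by (intro bchoice ballI)
  then obtain C where C: "\<forall>\<sigma>\<in>?S. ?B \<sigma> (C \<sigma>)" by (rule exE)
  have C_nonneg: "C \<sigma> \<ge> 0" if "\<sigma> \<in> ?S" for \<sigma>
    by (rule bspec[OF C that, THEN conjunct1])
  define K where "K = 1 + (\<Sum>\<sigma>\<in>?S. C \<sigma>)"
  have K: "C \<sigma> \<le> K" if "\<sigma> \<in> ?S" for \<sigma>
    using member_le_sum[of \<sigma> ?S C] that C_nonneg \<open>finite ?S\<close> by (simp add: K_def)
  have "K > 0"
    using sum_nonneg[of ?S C] C_nonneg by (simp add: K_def)
  moreover have "?d x y \<le> K * (\<Sum>k=1..m. \<bar>max_filter G (z k) x - max_filter G (z k) y\<bar>)" for x y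
  proof -
    have "\<exists>g. \<forall>k. g k \<in> G \<and> max_filter G (z k) u = u \<bullet> perm_act (g k) (z k)" for u
      using max_filter_attained by (intro choice allI) blast
    then obtain g h
      where g: "\<And>k. g k \<in> G" "\<And>k. max_filter G (z k) x = x \<bullet> perm_act (g k) (z k)"
        and h: "\<And>k. h k \<in> G" "\<And>k. max_filter G (z k) y = y \<bullet> perm_act (h k) (z k)"
      by meson
    define \<sigma> where "\<sigma> = (\<lambda>k\<in>{1..m}. (g k, h k))"
    have \<sigma>: "\<sigma> \<in> ?S" using g(1) h(1) by (auto simp: \<sigma>_def)
    have eq: "(\<Sum>k=1..m. \<bar>pair_functional (\<sigma> k) (z k) \<bullet> (x, y)\<bar>) =
        (\<Sum>k=1..m. \<bar>max_filter G (z k) x - max_filter G (z k) y\<bar>)"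
      by (intro sum.cong refl) (simp add: \<sigma>_def g(2) h(2) pair_functional_def inner_commute)
    have "?d x y \<le> C \<sigma> * (\<Sum>k=1..m. \<bar>max_filter G (z k) x - max_filter G (z k) y\<bar>)"
      using bspec[OF C \<sigma>] unfolding eq[symmetric] by blast
    also have "\<dots> \<le> K * (\<Sum>k=1..m. \<bar>max_filter G (z k) x - max_filter G (z k) y\<bar>)"
      by (intro mult_right_mono K \<sigma> sum_nonneg) simp
    finally show ?thesis .
  qed
  ultimately show ?thesis by blast
qed

section \<open>Max filters as bi-Lipschitz embeddings\<close>

lemma separates_orbits_of_lower_bound:
  assumes "\<And>x y. orbit_dist G (perm_orbit G x) (perm_orbit G y) \<le> C * (\<Sum>k\<in>I. \<bar>F k x - F k y\<bar>)"
  shows "separates_orbits G I F"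
  unfolding separates_orbits_def
proof (intro allI impI)
  fix x y assume "\<forall>i\<in>I. F i x = F i y"
  then have "orbit_dist G (perm_orbit G x) (perm_orbit G y) \<le> 0"
    using assms[of x y] by simp
  moreover obtain g where "g \<in> G" "orbit_dist G (perm_orbit G x) (perm_orbit G y) = norm (x - perm_act g y)"
    using orbit_dist_attained by blast
  ultimately show "perm_orbit G x = perm_orbit G y"
    by (simp add: perm_orbit_perm_act)
qed

lemma induces_bilipschitz_embedding_max_filters:
  assumes C: "C > 0" and
    lower: "\<And>x y. orbit_dist G (perm_orbit G x) (perm_orbit G y) \<le>
      C * (\<Sum>k=1..m. \<bar>max_filter G (z k) x - max_filter G (z k) y\<bar>)"
  shows "induces_bilipschitz_embedding G m (\<lambda>k. max_filter G (z k))"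
proof -
  let ?F = "\<lambda>k. max_filter G (z k)"
  let ?d = "\<lambda>x y. orbit_dist G (perm_orbit G x) (perm_orbit G y)"
  define \<Phi> where "\<Phi> = (\<lambda>X k. ?F k (SOME x. X = perm_orbit G x))"
  have \<Phi>: "\<Phi> (perm_orbit G x) k = ?F k x" for x k
  proof -
    have "perm_orbit G x = perm_orbit G (SOME u. perm_orbit G x = perm_orbit G u)"
      by (rule someI[of _ x]) simp
    from perm_orbit_eq_imp[OF this] show ?thesis
      unfolding \<Phi>_def by (metis max_filter_perm_act)
  qed
  define e where "e = (\<lambda>x y. euclid_dist m (\<Phi> (perm_orbit G x)) (\<Phi> (perm_orbit G y)))"
  have e: "e x y = L2_set (\<lambda>k. ?F k x - ?F k y) {1..m}" for x y
    by (simp add: e_def euclid_dist_def \<Phi>)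
  \<comment> \<open>The \<open>\<ell>\<^sup>1\<close> norm is at most \<open>m\<close> times the \<open>\<ell>\<^sup>2\<close> norm; \<open>m + 1\<close> keeps the constant positive.\<close>
  have lower': "1 / (C * (m + 1)) * ?d x y \<le> e x y" for x y
  proof -
    have "(\<Sum>k=1..m. \<bar>?F k x - ?F k y\<bar>) \<le> (\<Sum>k=1..m. e x y)"
    proof (rule sum_mono)
      fix k assume "k \<in> {1..m}"
      then show "\<bar>?F k x - ?F k y\<bar> \<le> e x y"
        unfolding e using member_le_L2_set[of "{1..m}" k "\<lambda>k. \<bar>?F k x - ?F k y\<bar>"]
        by (simp add: L2_set_def)
    qed
    also have "\<dots> \<le> (m + 1) * e x y"
      by (simp add: e distrib_right)
    finally have "C * (\<Sum>k=1..m. \<bar>?F k x - ?F k y\<bar>) \<le> C * ((m + 1) * e x y)"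
      using C by (intro mult_left_mono) auto
    with lower[of x y] have "?d x y \<le> C * ((m + 1) * e x y)" by linarith
    moreover have "C * (m + 1) > 0" using C by simp
    ultimately show ?thesis by (simp add: pos_divide_le_eq mult.commute mult.left_commute)
  qed
  have upper: "e x y \<le> (\<Sum>k=1..m. norm (z k)) * ?d x y" for x y
  proof -
    have "e x y \<le> (\<Sum>k=1..m. \<bar>?F k x - ?F k y\<bar>)"
      unfolding e by (rule L2_set_le_sum_abs)
    also have "\<dots> \<le> (\<Sum>k=1..m. norm (z k) * ?d x y)"
      by (intro sum_mono max_filter_orbit_dist_le)
    finally show ?thesis by (simp add: sum_distrib_right)
  qed
  have "bilipschitz_embedding (orbit_space G) (orbit_dist G) (euclid_dist m) \<Phi>"
    unfolding bilipschitz_embedding_def orbit_space_def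
    using C lower' upper unfolding e_def
    by (intro exI[of _ "1 / (C * (m + 1))"] exI[of _ "\<Sum>k=1..m. norm (z k)"]) auto
  with \<Phi> show ?thesis
    unfolding induces_bilipschitz_embedding_def by blast
qed

section \<open>The number of continuous separating invariants\<close>

text \<open>
  The centre \<open>c\<close> of the ball has pairwise distinct natural coordinates. If a permutation maps a point
  of the ball to another and takes the index \<open>j\<close> to \<open>i\<close>, then \<open>\<bar>c\<^sub>i - c\<^sub>j\<bar> < 1\<close> and hence \<open>i = j\<close>.
\<close>

lemma ex_ball_perm_orbit_inj:
  "\<exists>c. inj_on (perm_orbit G) (ball c (1/2))"
proof -
  obtain r :: "'n \<Rightarrow> nat" where r: "inj r"
    using finite_imp_inj_to_nat_seg[of "UNIV :: 'n set"] by auto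
  let ?c = "(\<chi> i. real (r i)) :: real ^ 'n"
  have close: "\<bar>real (r i) - x $ i\<bar> < 1/2" if "x \<in> ball ?c (1/2)" for x i
    using that component_le_norm_cart[of "?c - x" i] by (simp add: dist_norm)
  have "inj_on (perm_orbit G) (ball ?c (1/2))"
  proof (rule inj_onI)
    fix x y assume x: "x \<in> ball ?c (1/2)" and y: "y \<in> ball ?c (1/2)"
      and "perm_orbit G x = perm_orbit G y"
    then obtain g where g: "x = perm_act g y" using perm_orbit_eq_imp by blast
    have "x $ i = y $ i" for i
    proof -
      let ?j = "inv_into UNIV g i"
      have xi: "x $ i = y $ ?j" by (simp add: g perm_act_def)
      with close[OF x, of i] close[OF y, of ?j] have "\<bar>real (r i) - real (r ?j)\<bar> < 1" by linarith
      then have "r i = r ?j" by linarith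
      then have "?j = i" using r by (simp add: inj_eq)
      with xi show ?thesis by simp
    qed
    then show "x = y" by (simp add: vec_eq_iff)
  qed
  then show ?thesis by blast
qed

lemma card_separating_continuous_ge:
  fixes h :: "'i \<Rightarrow> real ^ 'n \<Rightarrow> real"
  assumes "finite I" and cont: "\<And>i. i \<in> I \<Longrightarrow> continuous_on UNIV (h i)"
    and sep: "separates_orbits G I h"
  shows "CARD('n) \<le> card I"
proof (rule ccontr)
  assume less: "\<not> CARD('n) \<le> card I"
  obtain \<phi> :: "'i \<Rightarrow> 'n" where \<phi>: "inj_on \<phi> I"
    using card_le_inj[of I "UNIV :: 'n set"] assms(1) less by auto
  have "card (\<phi> ` I) \<noteq> CARD('n)" using less card_image_le[OF assms(1), of \<phi>] by simp
  then obtain j where j: "j \<notin> \<phi> ` I" by (metis UNIV_eq_I)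
  \<comment> \<open>Padding the invariants with zeros gives a map of \<open>\<real>\<^sup>N\<close> to itself whose \<open>j\<close>-th entry vanishes.\<close>
  define f :: "real ^ 'n \<Rightarrow> real ^ 'n"
    where "f x = (\<chi> k. if k \<in> \<phi> ` I then h (the_inv_into I \<phi> k) x else 0)" for x
  have fj: "f x $ j = 0" for x using j by (simp add: f_def)
  have f\<phi>: "f x $ \<phi> i = h i x" if "i \<in> I" for x i
    using that \<phi> by (simp add: f_def the_inv_into_f_f)
  obtain c :: "real ^ 'n" where c: "inj_on (perm_orbit G) (ball c (1/2))"
    using ex_ball_perm_orbit_inj by blast
  let ?U = "ball c (1/2)"
  have "continuous_on UNIV (\<lambda>x. if k \<in> \<phi> ` I then h (the_inv_into I \<phi> k) x else 0)" for k
  proof (cases "k \<in> \<phi> ` I")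
    case True
    then show ?thesis using cont \<phi> by (auto simp: the_inv_into_f_f)
  qed simp
  then have "continuous_on UNIV f"
    unfolding f_def by (intro continuous_on_vec_lambda)
  then have cont_f: "continuous_on ?U f"
    by (rule continuous_on_subset) simp
  have inj_f: "inj_on f ?U"
  proof (rule inj_onI)
    fix x y assume xy: "x \<in> ?U" "y \<in> ?U" "f x = f y"
    then have "\<forall>i\<in>I. h i x = h i y" using f\<phi> by metis
    then have "perm_orbit G x = perm_orbit G y"
      using sep by (simp add: separates_orbits_def)
    with c xy show "x = y" by (meson inj_onD)
  qed
  have "open (f ` ?U)"
    by (rule invariance_of_domain[OF cont_f open_ball inj_f])
  moreover have "f c \<in> f ` ?U" by simp
  ultimately obtain e where e: "e > 0" "ball (f c) e \<subseteq> f ` ?U"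
    unfolding open_contains_ball by blast
  have "f c + (e/2) *\<^sub>R axis j 1 \<in> ball (f c) e"
    using e(1) by (simp add: dist_norm)
  then obtain x where x: "f x = f c + (e/2) *\<^sub>R axis j 1"
    using e(2) by (metis (no_types, lifting) imageE subsetD)
  have "(f c + (e/2) *\<^sub>R axis j 1) $ j = 0"
    using fj[of x] by (simp only: x)
  then show False using e(1) fj[of c] by simp
qed

end

section \<open>The embedding theorem\<close>

theorem corollary4p4:
  fixes G :: "('n::finite \<Rightarrow> 'n) set"
  assumes "subgroup G (BijGroup UNIV)"
  shows "(\<exists>z :: nat \<Rightarrow> real ^ 'n.
            (\<forall>k\<in>{1..2 * CARD('n)}. z k \<in> nat_vectors - {0}) \<and>
            (\<forall>k\<in>{1..2 * CARD('n) + 1}.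
               tropical_polynomial (filter_family G z k) \<and> perm_invariant G (filter_family G z k)) \<and>
            separates_orbits G {1..2 * CARD('n) + 1} (filter_family G z) \<and>
            induces_bilipschitz_embedding G (2 * CARD('n) + 1) (filter_family G z)) \<and>
         (\<forall>(I :: 'i set) (h :: 'i \<Rightarrow> real ^ 'n \<Rightarrow> real).
            (\<forall>i\<in>I. continuous_on UNIV (h i) \<and> perm_invariant G (h i)) \<and> separates_orbits G I h \<longrightarrow>
            infinite I \<or> CARD('n) \<le> card I)"
proof (rule conjI)
  interpret perm_group G by (rule perm_group.intro) (rule assms)
  let ?m = "2 * CARD('n)"
  obtain z :: "nat \<Rightarrow> real ^ 'n" where z: "\<forall>k\<in>{1..?m}. z k \<in> nat_vectors - {0}"
    and graph: "\<And>\<sigma>. (\<forall>k\<in>{1..?m}. \<sigma> k \<in> G \<times> G) \<Longrightarrow> \<exists>\<gamma>\<in>G. pair_kernel z \<sigma> ?m \<subseteq> perm_graph \<gamma>"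
    using ex_templates_pair_kernel_in_graph by blast
  obtain C where C: "C > 0" and
    lower: "\<And>x y. orbit_dist G (perm_orbit G x) (perm_orbit G y) \<le>
       C * (\<Sum>k=1..?m. \<bar>max_filter G (z k) x - max_filter G (z k) y\<bar>)"
    using orbit_dist_bounded_by_max_filters[OF graph] by blast
  define z' where "z' = (\<lambda>k. if k \<le> ?m then z k else (\<chi> i. 1))"
  have family: "filter_family G z = (\<lambda>k. max_filter G (z' k))"
    by (simp add: fun_eq_iff filter_family_def z'_def coord_sum_eq_max_filter)
  have z': "z' k \<in> nat_vectors" if "k \<in> {1..?m + 1}" for k
    using that z by (auto simp: z'_def nat_vectors_def)
  have lower': "orbit_dist G (perm_orbit G x) (perm_orbit G y) \<le>
      C * (\<Sum>k=1..?m + 1. \<bar>max_filter G (z' k) x - max_filter G (z' k) y\<bar>)" for x y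
  proof -
    have "(\<Sum>k=1..?m. \<bar>max_filter G (z k) x - max_filter G (z k) y\<bar>) =
        (\<Sum>k=1..?m. \<bar>max_filter G (z' k) x - max_filter G (z' k) y\<bar>)"
      by (intro sum.cong) (auto simp: z'_def)
    also have "\<dots> \<le> (\<Sum>k=1..?m + 1. \<bar>max_filter G (z' k) x - max_filter G (z' k) y\<bar>)"
      by (intro sum_mono2) auto
    finally show ?thesis
      using lower[of x y] mult_left_mono[OF _ less_imp_le[OF C]] by (meson order_trans)
  qed
  show "\<exists>z :: nat \<Rightarrow> real ^ 'n.
            (\<forall>k\<in>{1..2 * CARD('n)}. z k \<in> nat_vectors - {0}) \<and>
            (\<forall>k\<in>{1..2 * CARD('n) + 1}.
               tropical_polynomial (filter_family G z k) \<and> perm_invariant G (filter_family G z k)) \<and>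
            separates_orbits G {1..2 * CARD('n) + 1} (filter_family G z) \<and>
            induces_bilipschitz_embedding G (2 * CARD('n) + 1) (filter_family G z)"
  proof (intro exI[of _ z] conjI z ballI)
    fix k assume "k \<in> {1..?m + 1}"
    then show "tropical_polynomial (filter_family G z k)"
      unfolding family by (intro tropical_polynomial_max_filter z')
    show "perm_invariant G (filter_family G z k)"
      unfolding family perm_invariant_def by (simp add: max_filter_perm_act)
  next
    show "separates_orbits G {1..?m + 1} (filter_family G z)"
      unfolding family by (rule separates_orbits_of_lower_bound[OF lower'])
    show "induces_bilipschitz_embedding G (?m + 1) (filter_family G z)"
      unfolding family by (rule induces_bilipschitz_embedding_max_filters[OF C lower'])
  qed
next
  interpret perm_group G by (rule perm_group.intro) (rule assms)
  show "\<forall>(I :: 'i set) (h :: 'i \<Rightarrow> real ^ 'n \<Rightarrow> real).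
            (\<forall>i\<in>I. continuous_on UNIV (h i) \<and> perm_invariant G (h i)) \<and> separates_orbits G I h \<longrightarrow>
            infinite I \<or> CARD('n) \<le> card I"
    using card_separating_continuous_ge by blast
qed

end
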